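(* Let $\alpha \in \mathbb{N}$ with $\alpha \geq 2$, and let $G$ be a circular arc graph on $n$ vertices with maximum degree $\Delta$. If $$\Delta < \left\lfloor \frac{n(\alpha-1)}{2\alpha} \right\rfloor,$$ then $box(G) \leq \alpha$.
   Context: All graphs are simple, finite and undirected. A circular arc graph is a graph that is the intersection graph of a family of arcs on a circle: each vertex is assigned an arc, and two distinct vertices are adjacent if and only if their arcs intersect. A $k$-dimensional box (or $k$-box) is a Cartesian product $R_1 \times \cdots \times R_k$ where each $R_i$ is a closed interval on the real line. The boxicity $box(G)$ of a graph $G$ is the minimum integer $k$ such that $G$ is the intersection graph of a family of $k$-boxes (one box per vertex; two distinct vertices are adjacent if and only if their boxes intersect). *)

theory Defs
  imports "HOL-Analysis.Analysis" "Graph_Theory.Digraph"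
begin

text \<open>
  Finite simple undirected graphs are the locale \<^locale>\<open>graph\<close>: finite, loop-free, symmetric
  digraphs without parallel arcs. An undirected edge \<open>uv\<close> is the pair of arcs \<open>(u,v)\<close>, \<open>(v,u)\<close>,
  so the degree of a vertex is its out-degree (an edge must not be counted twice).
\<close>

definition max_degree :: "('a, 'b) pre_digraph \<Rightarrow> nat" where
  "max_degree G = Max (out_degree G ` verts G)"

definition intersection_graph_of :: "('a, 'b) pre_digraph \<Rightarrow> ('a \<Rightarrow> 'p set) \<Rightarrow> bool" where
  "intersection_graph_of G F \<longleftrightarrow>
     (\<forall>u\<in>verts G. \<forall>v\<in>verts G. u \<noteq> v \<longrightarrow> (u \<rightarrow>\<^bsub>G\<^esub> v \<longleftrightarrow> F u \<inter> F v \<noteq> {}))"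

text \<open>
  The circle is the unit circle in the complex plane. Arcs are closed and nonempty; single points
  and (for \<open>b - a \<ge> 2 * pi\<close>) the whole circle are included.
\<close>

definition circle_arc :: "complex set \<Rightarrow> bool" where
  "circle_arc A \<longleftrightarrow> (\<exists>a b. a \<le> b \<and> A = cis ` {a..b})"

definition circular_arc_graph :: "('a, 'b) pre_digraph \<Rightarrow> bool" where
  "circular_arc_graph G \<longleftrightarrow>
     graph G \<and> (\<exists>A. (\<forall>v\<in>verts G. circle_arc (A v)) \<and> intersection_graph_of G A)"

text \<open>
  Points of \<open>k\<close>-dimensional space are functions on \<open>{..<k}\<close> (extensional, i.e. \<open>undefined\<close>
  elsewhere), since \<open>k\<close> varies in the definition of boxicity. The unique \<open>0\<close>-box is a single
  point, so complete graphs have boxicity \<open>0\<close>.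
\<close>

definition closed_interval :: "real set \<Rightarrow> bool" where
  "closed_interval I \<longleftrightarrow> (\<exists>a b. a \<le> b \<and> I = {a..b})"

definition is_box :: "nat \<Rightarrow> (nat \<Rightarrow> real) set \<Rightarrow> bool" where
  "is_box k B \<longleftrightarrow> (\<exists>R. (\<forall>i<k. closed_interval (R i)) \<and> B = (\<Pi>\<^sub>E i\<in>{..<k}. R i))"

definition box_representable :: "('a, 'b) pre_digraph \<Rightarrow> nat \<Rightarrow> bool" where
  "box_representable G k \<longleftrightarrow>
     (\<exists>B. (\<forall>v\<in>verts G. is_box k (B v)) \<and> intersection_graph_of G B)"

definition boxicity :: "('a, 'b) pre_digraph \<Rightarrow> nat" where
  "boxicity G = (LEAST k. box_representable G k)"

text \<open>The minimum defining the boxicity of a finite simple graph is attained.\<close>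

lemma box_representable_card:
  assumes "graph G"
  shows "box_representable G (card (verts G))"
proof -
  interpret graph G by fact
  define k where "k = card (verts G)"
  obtain h where h: "bij_betw h {..<k} (verts G)"
    using ex_bij_betw_nat_finite[OF finite_verts] by (auto simp: k_def atLeast0LessThan)
  define R where "R v i =
    (if v = h i then {0..0} else if v \<rightarrow>\<^bsub>G\<^esub> h i then {0..1} else {1..1::real})" for v i
  define B where "B v = (\<Pi>\<^sub>E i\<in>{..<k}. R v i)" for v
  have "is_box k (B v)" for v
    unfolding is_box_def B_def closed_interval_def
    by (rule exI[of _ "R v"]) (force simp: R_def)
  moreover have "u \<rightarrow>\<^bsub>G\<^esub> v \<longleftrightarrow> B u \<inter> B v \<noteq> {}"
    if uv: "u \<in> verts G" "v \<in> verts G" "u \<noteq> v" for u v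
  proof
    assume adj: "u \<rightarrow>\<^bsub>G\<^esub> v"
    then have adj': "v \<rightarrow>\<^bsub>G\<^esub> u" using sym_arcs by (rule arcs_ends_symmetric[rotated])
    have "(\<lambda>i\<in>{..<k}. if u = h i \<or> v = h i then 0 else 1) \<in> B u \<inter> B v"
      using adj adj' by (auto simp: B_def R_def)
    then show "B u \<inter> B v \<noteq> {}" by blast
  next
    assume "B u \<inter> B v \<noteq> {}"
    then obtain x where x: "x \<in> B u" "x \<in> B v" by blast
    obtain i where i: "i < k" "h i = v"
      using h uv(2) by (metis bij_betw_iff_bijections lessThan_iff)
    have "x i \<in> R u i" "x i \<in> R v i" using x i by (auto simp: B_def)
    then show "u \<rightarrow>\<^bsub>G\<^esub> v" using i uv(3) by (auto simp: R_def split: if_splits)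
  qed
  ultimately show ?thesis
    unfolding box_representable_def intersection_graph_of_def k_def[symmetric] by blast
qed

end

theory Submission
  imports Defs
begin

text \<open>
  Project the circle onto the \<open>\<alpha>\<close> diameters whose directions are the multiples of \<open>pi / \<alpha>\<close>; each
  arc becomes a box, and intersecting arcs give intersecting boxes. Two disjoint arcs are separated
  by a chord joining the two gaps between them, and the directions perpendicular to such chords fill
  an open interval whose length is half the total length of the gaps. If all arcs are shorter than
  \<open>pi * (\<alpha> - 1) / \<alpha>\<close>, this interval is longer than \<open>pi / \<alpha>\<close>, so one of the \<open>\<alpha>\<close> projections
  separates the two arcs.

  The degree bound yields short arcs after a reparametrization of the circle that spaces the \<open>2n\<close>
  endpoints evenly: an arc contains endpoints of its neighbours only, so its length becomes at most
  \<open>(2 * \<Delta> + 1) * pi / n\<close>.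
\<close>

section \<open>Arcs as real intervals modulo full turns\<close>

lemma image_meets_image_iff:
  "f ` X \<inter> g ` Y \<noteq> {} \<longleftrightarrow> (\<exists>x\<in>X. \<exists>y\<in>Y. f x = g y)"
  by (force simp: set_eq_iff image_iff)

lemma cis_eq_cis_iff: "cis x = cis y \<longleftrightarrow> (\<exists>k::int. x = y + 2 * pi * k)"
  using sin_cos_eq_iff[of x y] by (auto simp: complex_eq_iff)

lemma cis_arcs_meet_iff:
  assumes "a \<le> b" "c \<le> d"
  shows "cis ` {a..b} \<inter> cis ` {c..d} \<noteq> {} \<longleftrightarrow>
    (\<exists>k::int. a \<le> d + 2 * pi * k \<and> c + 2 * pi * k \<le> b)"
proof
  assume "cis ` {a..b} \<inter> cis ` {c..d} \<noteq> {}"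
  then obtain x y where "x \<in> {a..b}" "y \<in> {c..d}" "cis x = cis y"
    by (force simp only: image_meets_image_iff)
  moreover from this obtain k :: int where "x = y + 2 * pi * k"
    by (auto simp: cis_eq_cis_iff)
  ultimately show "\<exists>k::int. a \<le> d + 2 * pi * k \<and> c + 2 * pi * k \<le> b"
    by (intro exI[of _ k]) auto
next
  assume "\<exists>k::int. a \<le> d + 2 * pi * k \<and> c + 2 * pi * k \<le> b"
  then obtain k :: int where k: "a \<le> d + 2 * pi * k" "c + 2 * pi * k \<le> b" by blast
  define x where "x = max a (c + 2 * pi * k)"
  have "x \<in> {a..b}" "x - 2 * pi * k \<in> {c..d}"
    using k assms by (auto simp: x_def max_def)
  moreover have "cis x = cis (x - 2 * pi * k)"
    unfolding cis_eq_cis_iff by (intro exI[of _ k]) simp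
  ultimately show "cis ` {a..b} \<inter> cis ` {c..d} \<noteq> {}" by blast
qed

lemma cis_image_full_turn:
  assumes "a + 2 * pi \<le> b"
  shows "cis x \<in> cis ` {a..b}"
proof -
  have "cis ` {a..b} \<inter> cis ` {x..x} \<noteq> {}"
  proof (subst cis_arcs_meet_iff)
    define k where "k = \<lceil>(a - x) / (2 * pi)\<rceil>"
    have "(a - x) / (2 * pi) \<le> k" "k < (a - x) / (2 * pi) + 1"
      unfolding k_def by linarith+
    then have "a - x \<le> 2 * pi * k" "2 * pi * k < a - x + 2 * pi"
      by (simp_all add: field_simps)
    then show "\<exists>k::int. a \<le> x + 2 * pi * k \<and> x + 2 * pi * k \<le> b"
      using assms by (intro exI[of _ k]) auto
  qed (use assms pi_gt_zero in linarith)+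
  then show ?thesis by auto
qed

section \<open>Separating disjoint arcs by projection onto a diameter\<close>

lemma cos_gt_cos_near:
  assumes "\<bar>t\<bar> < h" "h \<le> pi"
  shows "cos h < cos t"
  using cos_monotone_0_pi[of "\<bar>t\<bar>" h] assms by simp

text \<open>Angles \<open>x\<close> and \<open>2 * \<theta> - x\<close> have the same projection in
  direction \<open>\<theta>\<close>, so the chord joining them is perpendicular to it. The bounds on
  \<open>\<theta>\<close> allow such a chord to have one end in each gap.\<close>

lemma chord_separates_arcs:
  assumes "a \<le> b" "b < c" "c \<le> d" "d < a + 2 * pi"
    and \<theta>: "b + d < 2 * \<theta>" "2 * \<theta> < a + c + 2 * pi"
    and "s \<in> {a..b}" "t \<in> {c..d}"
  shows "cos (s - \<theta>) < cos (t - \<theta>)"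
proof -
  have "max b (2 * \<theta> - a - 2 * pi) < min c (2 * \<theta> - d)" using assms by auto
  then obtain x where x: "max b (2 * \<theta> - a - 2 * pi) < x" "x < min c (2 * \<theta> - d)"
    using dense by blast
  define h where "h = \<theta> - x"
  \<comment> \<open>\<open>cos h\<close> is the projection of the chord. The arc
    \<open>{c..d}\<close> lies within \<open>h\<close> of \<open>\<theta>\<close>, and
    \<open>{a..b}\<close> within \<open>pi - h\<close> of the opposite direction
    \<open>\<theta> - pi\<close>.\<close>
  have "cos h < cos (t - \<theta>)"
    by (rule cos_gt_cos_near) (use x assms in \<open>auto simp: h_def abs_less_iff\<close>)
  moreover have "cos (pi - h) < cos (s - \<theta> + pi)"
    by (rule cos_gt_cos_near) (use x assms in \<open>auto simp: h_def abs_less_iff\<close>)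
  ultimately show ?thesis by (simp add: cos_diff)
qed

lemma ex_multiple_between:
  fixes w :: real
  assumes "0 < w" "w < q - p"
  shows "\<exists>j::int. p < w * j \<and> w * j < q"
proof (intro exI conjI)
  define j where "j = \<lfloor>p / w\<rfloor> + 1"
  have "p / w < j" "j - 1 \<le> p / w" unfolding j_def by linarith+
  then show "p < w * j" "w * j < q"
    using assms by (simp_all add: field_simps)
qed

lemma projection_separates_short_arcs:
  fixes m :: nat
  assumes "m \<ge> 1" "a \<le> b" "c \<le> d"
    and short: "b - a < pi * (real m - 1) / m" "d - c < pi * (real m - 1) / m"
    and disj: "\<nexists>k::int. a \<le> d + 2 * pi * k \<and> c + 2 * pi * k \<le> b"
  shows "\<exists>i<m. (\<lambda>t. cos (t - i * pi / m)) ` {a..b} \<inter> (\<lambda>t. cos (t - i * pi / m)) ` {c..d} = {}"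
proof -
  \<comment> \<open>The translate of \<open>{c..d}\<close> by \<open>k\<close> turns is the first to
    begin after \<open>b\<close>. Its predecessor begins at or before \<open>b\<close>, so
    disjointness makes it end before \<open>a\<close>.\<close>
  define k where "k = \<lfloor>(b - c) / (2 * pi)\<rfloor> + 1"
  define c' d' where "c' = c + 2 * pi * k" and "d' = d + 2 * pi * k"
  have "k - 1 \<le> (b - c) / (2 * pi)" "(b - c) / (2 * pi) < k"
    unfolding k_def by linarith+
  then have k: "c + 2 * pi * real_of_int (k - 1) \<le> b" "b < c'"
    by (simp_all add: c'_def field_simps)
  with disj have "d + 2 * pi * real_of_int (k - 1) < a" by (meson not_less)
  then have d': "d' < a + 2 * pi" by (simp add: d'_def algebra_simps)
  \<comment> \<open>The right-hand side is \<open>pi\<close> minus half the sum of the two arc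
    lengths.\<close>
  have "pi / m < (a + c' + 2 * pi) / 2 - (b + d') / 2"
    using short \<open>m \<ge> 1\<close> by (simp add: c'_def d'_def field_simps)
  from ex_multiple_between[OF _ this] \<open>m \<ge> 1\<close> obtain j :: int where
    j: "(b + d') / 2 < pi / m * j" "pi / m * j < (a + c' + 2 * pi) / 2" by auto
  \<comment> \<open>Directions differing by a multiple of \<open>pi\<close> span the same diameter,
    so \<open>j\<close> can be reduced modulo \<open>m\<close>. The projections may change sign,
    which reverses their order; hence only inequality is claimed below.\<close>
  define i where "i = nat (j mod m)"
  define q where "q = j div m"
  have "i < m" using \<open>m \<ge> 1\<close> by (simp add: i_def nat_less_iff)
  have "j = int i + int m * q" using \<open>m \<ge> 1\<close> by (simp add: i_def q_def)
  then have "real_of_int j = real i + real m * q" by simp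
  then have turn: "i * pi / m = pi / m * j - q * pi"
    using \<open>m \<ge> 1\<close> by (simp add: field_simps)
  define \<theta> where "\<theta> = pi / m * j"
  have j': "b + d' < 2 * \<theta>" "2 * \<theta> < a + c' + 2 * pi"
    using j unfolding \<theta>_def[symmetric] by simp_all
  have "cos (s - i * pi / m) \<noteq> cos (t - i * pi / m)" if st: "s \<in> {a..b}" "t \<in> {c..d}" for s t
  proof -
    have "cos (s - \<theta>) < cos (t + 2 * pi * k - \<theta>)"
      by (rule chord_separates_arcs[of a b c' d'])
        (use assms(2,3) k(2) d' j' st in \<open>auto simp: c'_def d'_def\<close>)
    also have "t + 2 * pi * k - \<theta> = (t - \<theta>) + 2 * pi * k" by simp
    also have "cos \<dots> = cos (t - \<theta>)" by (simp add: cos_add)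
    finally have "cos (s - \<theta>) \<noteq> cos (t - \<theta>)" by simp
    moreover have "cos (x - i * pi / m) = cos (x - \<theta>) * cos (q * pi)" for x
    proof -
      have "x - i * pi / m = (x - \<theta>) + q * pi" using turn by (simp add: \<theta>_def)
      also have "cos \<dots> = cos (x - \<theta>) * cos (q * pi)"
        by (subst cos_add) (simp add: sin_int_times_real sin_integer_2pi mult.commute[of _ pi])
      finally show ?thesis .
    qed
    moreover have "cos (q * pi) \<noteq> 0"
      using sin_zero_iff_int2[of "q * pi"] sin_cos_squared_add[of "q * pi"] by auto
    ultimately show ?thesis by simp
  qed
  with \<open>i < m\<close> show ?thesis by blast
qed

section \<open>Boxes from short arcs\<close>

lemma box_representable_if_short_arcs:
  fixes a b :: "'a \<Rightarrow> real"
  assumes "m \<ge> 1"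
    and le: "\<And>v. v \<in> verts G \<Longrightarrow> a v \<le> b v"
    and short: "\<And>v. v \<in> verts G \<Longrightarrow> b v - a v < pi * (real m - 1) / m"
    and rep: "intersection_graph_of G (\<lambda>v. cis ` {a v..b v})"
  shows "box_representable G m"
proof -
  define R where "R v i = (\<lambda>t. cos (t - real i * pi / m)) ` {a v..b v}" for v and i :: nat
  define B where "B v = (\<Pi>\<^sub>E i\<in>{..<m}. R v i)" for v
  have "is_box m (B v)" if "v \<in> verts G" for v
    unfolding is_box_def
  proof (intro exI[of _ "R v"] conjI allI impI)
    fix i
    have "continuous_on {a v..b v} (\<lambda>t. cos (t - real i * pi / m))"
      by (intro continuous_intros)
    from continuous_image_closed_interval[OF le[OF that] this]
    show "closed_interval (R v i)" unfolding closed_interval_def R_def by blast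
  qed (simp add: B_def)
  moreover have "u \<rightarrow>\<^bsub>G\<^esub> v \<longleftrightarrow> B u \<inter> B v \<noteq> {}"
    if uv: "u \<in> verts G" "v \<in> verts G" "u \<noteq> v" for u v
  proof -
    have "u \<rightarrow>\<^bsub>G\<^esub> v \<longleftrightarrow> cis ` {a u..b u} \<inter> cis ` {a v..b v} \<noteq> {}"
      using rep uv unfolding intersection_graph_of_def by blast
    also have "\<dots> \<longleftrightarrow> (\<forall>i<m. R u i \<inter> R v i \<noteq> {})"
    proof
      assume "cis ` {a u..b u} \<inter> cis ` {a v..b v} \<noteq> {}"
      then obtain s t where st: "s \<in> {a u..b u}" "t \<in> {a v..b v}" "cis s = cis t"
        by (force simp only: image_meets_image_iff)
      \<comment> \<open>The projection is a linear function of the point \<open>cis t\<close>, so it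
        does not depend on the angle chosen for that point.\<close>
      have "cos (s - x) = cos (t - x)" for x
        using st(3) by (simp add: cos_diff complex_eq_iff)
      then show "\<forall>i<m. R u i \<inter> R v i \<noteq> {}" using st(1,2) unfolding R_def by blast
    next
      assume "\<forall>i<m. R u i \<inter> R v i \<noteq> {}"
      then show "cis ` {a u..b u} \<inter> cis ` {a v..b v} \<noteq> {}"
        using projection_separates_short_arcs[of m "a u" "b u" "a v" "b v"] assms(1) uv le short
        unfolding R_def by (subst cis_arcs_meet_iff) blast+
    qed
    also have "\<dots> \<longleftrightarrow> B u \<inter> B v \<noteq> {}"
      by (auto simp: B_def PiE_Int PiE_eq_empty_iff)
    finally show ?thesis .
  qed
  ultimately show ?thesis
    unfolding box_representable_def intersection_graph_of_def by blast
qed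

section \<open>Counting the translates of an endpoint\<close>

text \<open>
  Counts the points \<open>e + 2 * pi * k\<close> between \<open>e\<close> and \<open>x\<close> (negatively if \<open>x < e\<close>), with weight one
  half at the two ends. The half weights let the reparametrization send a point where several
  endpoints coincide to the middle of the stretch reserved for them.
\<close>

definition turn_count :: "real \<Rightarrow> real \<Rightarrow> real" where
  "turn_count e x =
    (real_of_int \<lfloor>(x - e) / (2 * pi)\<rfloor> + real_of_int \<lceil>(x - e) / (2 * pi)\<rceil>) / 2"

lemma turn_count_mono: "x \<le> y \<Longrightarrow> turn_count e x \<le> turn_count e y"
  unfolding turn_count_def
  by (intro divide_right_mono add_mono of_int_le_iff[THEN iffD2] floor_mono ceiling_mono) auto

lemma turn_count_add_period:
  "turn_count e (x + 2 * pi * of_int k) = turn_count e x + k"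
proof -
  have "(x + 2 * pi * of_int k - e) / (2 * pi) = (x - e) / (2 * pi) + of_int k"
    by (simp add: field_simps)
  then show ?thesis unfolding turn_count_def by simp
qed

lemma turn_count_self: "turn_count e e = 0"
  by (simp add: turn_count_def)

text \<open>With \<open>turn_count_self\<close>, this gives a strict jump on reaching
  \<open>e\<close>, which later keeps left ends strictly beyond everything before them.\<close>

lemma turn_count_neg:
  assumes "x < e"
  shows "turn_count e x < 0"
proof -
  define X where "X = (x - e) / (2 * pi)"
  have "X < 0" using assms by (simp add: X_def divide_less_0_iff)
  then have "\<lfloor>X\<rfloor> \<le> - 1" "\<lceil>X\<rceil> \<le> 0" by linarith+
  then have "\<lfloor>X\<rfloor> + \<lceil>X\<rceil> < 0" by linarith
  then have "real_of_int (\<lfloor>X\<rfloor> + \<lceil>X\<rceil>) < of_int 0" by (subst of_int_less_iff)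
  then show ?thesis by (simp add: turn_count_def flip: X_def)
qed

text \<open>Applied, like the next lemma, to an arc's own two ends: if the arc is shorter than a
  full turn, each contributes at most one half.\<close>

lemma turn_count_le_half:
  assumes "x < e + 2 * pi"
  shows "turn_count e x \<le> 1 / 2"
proof -
  define X where "X = (x - e) / (2 * pi)"
  have "X < 1" using assms by (simp add: X_def)
  then have "\<lfloor>X\<rfloor> \<le> 0" "\<lceil>X\<rceil> \<le> 1" by linarith+
  then have "\<lfloor>X\<rfloor> + \<lceil>X\<rceil> \<le> 1" by linarith
  then have "real_of_int (\<lfloor>X\<rfloor> + \<lceil>X\<rceil>) \<le> of_int 1" by (subst of_int_le_iff)
  then show ?thesis by (simp add: turn_count_def flip: X_def)
qed

lemma turn_count_ge_minus_half:
  assumes "e - 2 * pi < x"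
  shows "- 1 / 2 \<le> turn_count e x"
proof -
  define X where "X = (x - e) / (2 * pi)"
  have "- 1 < X" using assms by (simp add: X_def field_simps)
  then have "- 1 \<le> \<lfloor>X\<rfloor>" "0 \<le> \<lceil>X\<rceil>" by linarith+
  then have "- 1 \<le> \<lfloor>X\<rfloor> + \<lceil>X\<rceil>" by linarith
  then have "of_int (- 1) \<le> real_of_int (\<lfloor>X\<rfloor> + \<lceil>X\<rceil>)" by (subst of_int_le_iff)
  then show ?thesis by (simp add: turn_count_def flip: X_def)
qed

lemma turn_count_diff_le_1:
  assumes "y \<le> x + 2 * pi"
  shows "turn_count e y - turn_count e x \<le> 1"
  using turn_count_mono[OF assms, of e] turn_count_add_period[of e x 1] by simp

lemma turn_count_eq:
  assumes "x \<le> y" and none: "\<nexists>k::int. x \<le> e + 2 * pi * k \<and> e + 2 * pi * k \<le> y"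
  shows "turn_count e x = turn_count e y"
proof -
  define X where "X = (x - e) / (2 * pi)"
  define Y where "Y = (y - e) / (2 * pi)"
  have XY: "X \<le> Y" using assms(1) by (simp add: X_def Y_def divide_right_mono)
  have "\<not> (X \<le> of_int k \<and> of_int k \<le> Y)" for k :: int
    using none by (auto simp: X_def Y_def field_simps)
  \<comment> \<open>An integer in \<open>[X, Y]\<close> is excluded, so the last integer up to
    \<open>Y\<close> lies before \<open>X\<close> and the first one from \<open>X\<close> on lies
    after \<open>Y\<close>.\<close>
  from this[of "\<lfloor>Y\<rfloor>"] this[of "\<lceil>X\<rceil>"] have "of_int \<lfloor>Y\<rfloor> < X" "Y < of_int \<lceil>X\<rceil>"
    by (auto simp: not_le)
  then have "\<lfloor>X\<rfloor> = \<lfloor>Y\<rfloor>" "\<lceil>X\<rceil> = \<lceil>Y\<rceil>" using XY by linarith+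
  then show ?thesis by (simp add: turn_count_def X_def Y_def)
qed

section \<open>Reparametrizing the circle to shorten the arcs\<close>

lemma (in fin_digraph) card_neighbours_le_max_degree:
  assumes "u \<in> verts G"
  shows "card {v. u \<rightarrow>\<^bsub>G\<^esub> v} \<le> max_degree G"
proof -
  have "{v. u \<rightarrow>\<^bsub>G\<^esub> v} \<subseteq> head G ` out_arcs G u"
    by (auto simp: arcs_ends_def arc_to_ends_def)
  then have "card {v. u \<rightarrow>\<^bsub>G\<^esub> v} \<le> card (head G ` out_arcs G u)"
    by (intro card_mono) auto
  also have "\<dots> \<le> out_degree G u"
    unfolding out_degree_def by (rule card_image_le) (rule finite_out_arcs)
  also have "\<dots> \<le> max_degree G" unfolding max_degree_def using assms by simp
  finally show ?thesis .
qed

text \<open>Whether two arcs meet depends only on comparisons of a left end with a translated right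
  end. A monotone map that commutes with full turns and is strict just below left ends preserves
  them.\<close>

lemma short_arcs_representation:
  assumes "circular_arc_graph G" and "max_degree G + 1 < card (verts G)"
  obtains a b :: "'a \<Rightarrow> real"
  where "\<And>v. v \<in> verts G \<Longrightarrow> a v \<le> b v"
    and "\<And>v. v \<in> verts G \<Longrightarrow> b v - a v \<le> pi * (2 * max_degree G + 1) / card (verts G)"
    and "intersection_graph_of G (\<lambda>v. cis ` {a v..b v})"
proof -
  define V where "V = verts G"
  define n where "n = card V"
  from assms(1) obtain A where "graph G" and arc: "\<And>v. v \<in> V \<Longrightarrow> circle_arc (A v)"
    and A: "intersection_graph_of G A"
    unfolding circular_arc_graph_def V_def by blast
  interpret graph G by fact
  have "finite V" by (simp add: V_def)
  have n: "max_degree G + 1 < n" using assms(2) by (simp add: n_def V_def)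
  from arc have "\<forall>v\<in>V. \<exists>a b. a \<le> b \<and> A v = cis ` {a..b}" by (simp add: circle_arc_def)
  then obtain a b where ab: "\<And>v. v \<in> V \<Longrightarrow> a v \<le> b v"
    and A_eq: "\<And>v. v \<in> V \<Longrightarrow> A v = cis ` {a v..b v}" by metis
  have adj_iff: "u \<rightarrow>\<^bsub>G\<^esub> v \<longleftrightarrow> (\<exists>k::int. a u \<le> b v + 2 * pi * k \<and> a v + 2 * pi * k \<le> b u)"
    if "u \<in> V" "v \<in> V" "u \<noteq> v" for u v
    using A that cis_arcs_meet_iff[OF ab ab, of u v]
    by (auto simp: intersection_graph_of_def V_def A_eq)

  \<comment> \<open>An arc covering the circle would have all \<open>n - 1\<close> other vertices as
    neighbours, more than the maximum degree.\<close>
  have not_full: "b u < a u + 2 * pi" if "u \<in> V" for u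
  proof (rule ccontr)
    assume "\<not> b u < a u + 2 * pi"
    then have "cis x \<in> A u" for x using cis_image_full_turn that A_eq by (metis not_less)
    then have "A u \<inter> A v \<noteq> {}" if "v \<in> V" for v using A_eq[OF that] ab[OF that] by fastforce
    then have "V - {u} \<subseteq> {v. u \<rightarrow>\<^bsub>G\<^esub> v}"
      using A that by (auto simp: intersection_graph_of_def V_def)
    then have "card (V - {u}) \<le> card {v. u \<rightarrow>\<^bsub>G\<^esub> v}"
      by (intro card_mono finite_subset[OF _ \<open>finite V\<close>]) (auto simp: V_def dest: adj_in_verts)
    also have "\<dots> \<le> max_degree G"
      using that by (intro card_neighbours_le_max_degree) (simp add: V_def)
    finally show False using n that by (simp add: n_def)
  qed

  \<comment> \<open>Each of the \<open>2 * n\<close> endpoints adds 1 to the sum per turn, so the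
    factor \<open>pi / n\<close> makes \<open>f\<close> gain \<open>2 * pi\<close> per turn.\<close>
  define f where "f x = pi / n * (\<Sum>v\<in>V. turn_count (a v) x + turn_count (b v) x)" for x
  have f_mono: "f x \<le> f y" if "x \<le> y" for x y
    unfolding f_def using that
    by (intro mult_left_mono sum_mono add_mono turn_count_mono) auto
  have f_period: "f (x + 2 * pi * of_int k) = f x + 2 * pi * of_int k" for x and k :: int
    using n unfolding f_def turn_count_add_period
    by (simp add: sum.distrib n_def field_simps)
  have f_strict: "f y < f (a u)" if "u \<in> V" "y < a u" for u y
  proof -
    have "turn_count (a u) y < turn_count (a u) (a u)"
      using turn_count_neg[OF that(2)] by (simp add: turn_count_self)
    then have "(\<Sum>v\<in>V. turn_count (a v) y + turn_count (b v) y)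
        < (\<Sum>v\<in>V. turn_count (a v) (a u) + turn_count (b v) (a u))"
      using that turn_count_mono[of y "a u"] \<open>finite V\<close>
      by (intro sum_strict_mono_ex1 bexI[of _ u] ballI add_mono) (auto intro: add_less_le_mono)
    then show ?thesis unfolding f_def using n by (intro mult_strict_left_mono) auto
  qed
  have f_le: "f (a u) \<le> f y \<longleftrightarrow> a u \<le> y" if "u \<in> V" for u y
    using f_mono[of "a u" y] f_strict[OF that, of y] by (meson not_le)
  have iff1: "a u \<le> b v + 2 * pi * k \<longleftrightarrow> f (a u) \<le> f (b v) + 2 * pi * k"
    if "u \<in> V" for u v and k :: int
    using f_le[OF that, of "b v + 2 * pi * k"] by (simp add: f_period)
  have iff2: "a v + 2 * pi * k \<le> b u \<longleftrightarrow> f (a v) + 2 * pi * k \<le> f (b u)"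
    if "v \<in> V" for u v and k :: int
    using iff1[OF that, of u "- k"] by (simp add: algebra_simps)
  have "intersection_graph_of G (\<lambda>v. cis ` {f (a v)..f (b v)})"
    unfolding intersection_graph_of_def V_def[symmetric]
    using adj_iff iff1 iff2 cis_arcs_meet_iff[OF f_mono f_mono] ab by simp
  moreover have "f (b u) - f (a u) \<le> pi * (2 * max_degree G + 1) / card (verts G)"
    if "u \<in> V" for u
  proof -
    \<comment> \<open>The contribution of the two ends of \<open>v\<close> to the new length of arc
      \<open>u\<close>, in units of \<open>pi / n\<close>.\<close>
    define \<delta> where "\<delta> v = (turn_count (a v) (b u) - turn_count (a v) (a u))
      + (turn_count (b v) (b u) - turn_count (b v) (a u))" for v
    have "\<delta> u \<le> 1"
      using turn_count_le_half[of "b u" "a u"] turn_count_ge_minus_half[of "b u" "a u"]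
        not_full[OF that] by (simp add: \<delta>_def turn_count_self)
    moreover have "\<delta> v \<le> (if u \<rightarrow>\<^bsub>G\<^esub> v then 2 else 0)" if "v \<in> V - {u}" for v
    proof (cases "u \<rightarrow>\<^bsub>G\<^esub> v")
      case True
      then show ?thesis
        using not_full[OF \<open>u \<in> V\<close>] turn_count_diff_le_1[of "b u" "a u" "a v"]
          turn_count_diff_le_1[of "b u" "a u" "b v"] by (simp add: \<delta>_def)
    next
      case False
      then have none: "\<not> (a u \<le> b v + 2 * pi * k \<and> a v + 2 * pi * k \<le> b u)" for k :: int
        using adj_iff \<open>u \<in> V\<close> that by auto
      have "a v \<le> b v" using ab that by simp
      \<comment> \<open>A translate of an end of \<open>v\<close> inside \<open>{a u..b u}\<close>
        would be a common point of the two arcs.\<close>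
      then have "turn_count e (a u) = turn_count e (b u)" if "e \<in> {a v, b v}" for e
        using none that ab[OF \<open>u \<in> V\<close>] by (intro turn_count_eq) force+
      then show ?thesis using False by (simp add: \<delta>_def)
    qed
    ultimately have "sum \<delta> V \<le> 1 + (\<Sum>v\<in>V - {u}. if u \<rightarrow>\<^bsub>G\<^esub> v then 2 else 0)"
      unfolding sum.remove[OF \<open>finite V\<close> that] by (intro add_mono sum_mono)
    moreover have "(\<Sum>v\<in>V - {u}. if u \<rightarrow>\<^bsub>G\<^esub> v then 2 else 0 :: real) =
        2 * card {v \<in> V - {u}. u \<rightarrow>\<^bsub>G\<^esub> v}"
      using \<open>finite V\<close> by (simp add: sum.If_cases Int_def)
    moreover have "card {v \<in> V - {u}. u \<rightarrow>\<^bsub>G\<^esub> v} \<le> max_degree G"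
    proof -
      have "finite {v. u \<rightarrow>\<^bsub>G\<^esub> v}"
        by (rule finite_subset[OF _ \<open>finite V\<close>]) (auto simp: V_def dest: adj_in_verts)
      then have "card {v \<in> V - {u}. u \<rightarrow>\<^bsub>G\<^esub> v} \<le> card {v. u \<rightarrow>\<^bsub>G\<^esub> v}"
        by (rule card_mono) auto
      also have "\<dots> \<le> max_degree G"
        using that by (intro card_neighbours_le_max_degree) (simp add: V_def)
      finally show ?thesis .
    qed
    ultimately have "sum \<delta> V \<le> 2 * max_degree G + 1" by simp
    then have "pi / n * sum \<delta> V \<le> pi / n * (2 * max_degree G + 1)"
      by (intro mult_left_mono) auto
    moreover have "f (b u) - f (a u) = pi / n * sum \<delta> V"
      unfolding f_def \<delta>_def right_diff_distrib[symmetric] sum_subtractf[symmetric]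
      by (simp add: algebra_simps)
    ultimately show ?thesis by (simp add: n_def V_def)
  qed
  ultimately show ?thesis using that[of "f \<circ> a" "f \<circ> b"] f_mono ab by (simp add: V_def)
qed

theorem theorem3p10:
  fixes G :: "('a, 'b) pre_digraph" and \<alpha> :: nat
  assumes "\<alpha> \<ge> 2"
    and "circular_arc_graph G"
    and "int (max_degree G) < \<lfloor>real (card (verts G)) * (real \<alpha> - 1) / (2 * real \<alpha>)\<rfloor>"
  shows "boxicity G \<le> \<alpha>"
proof -
  define n where "n = card (verts G)"
  define \<Delta> where "\<Delta> = max_degree G"
  \<comment> \<open>A strict inequality between integers leaves room for the
    \<open>+ 1\<close>.\<close>
  have \<Delta>: "real \<Delta> + 1 \<le> n * (real \<alpha> - 1) / (2 * \<alpha>)"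
    using assms(3) unfolding n_def \<Delta>_def by linarith
  have "n > 0" using \<Delta> by (cases n) auto
  have "(real \<alpha> - 1) / (2 * \<alpha>) < 1" using assms(1) by (simp add: field_simps)
  from mult_strict_left_mono[OF this, of n] have "n * (real \<alpha> - 1) / (2 * \<alpha>) < n"
    using \<open>n > 0\<close> by simp
  with \<Delta> have "\<Delta> + 1 < n" by simp
  then obtain a b where le: "\<And>v. v \<in> verts G \<Longrightarrow> a v \<le> b v"
    and len: "\<And>v. v \<in> verts G \<Longrightarrow> b v - a v \<le> pi * (2 * \<Delta> + 1) / n"
    and rep: "intersection_graph_of G (\<lambda>v. cis ` {a v..b v})"
    using short_arcs_representation[OF assms(2)] unfolding \<Delta>_def n_def by blast
  \<comment> \<open>Doubling the bound gives \<open>2 * \<Delta> + 2\<close> with a weak inequality.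
    Strictness comes from an arc's own ends counting for one unit instead of two.\<close>
  have "2 * real \<Delta> + 1 < n * (real \<alpha> - 1) / \<alpha>" using \<Delta> assms(1) by (simp add: field_simps)
  then have "(2 * real \<Delta> + 1) / n < (real \<alpha> - 1) / \<alpha>"
    using \<open>n > 0\<close> by (simp add: field_simps)
  then have "pi * ((2 * real \<Delta> + 1) / n) < pi * ((real \<alpha> - 1) / \<alpha>)"
    by (rule mult_strict_left_mono) simp
  then have "pi * (2 * \<Delta> + 1) / n < pi * (real \<alpha> - 1) / \<alpha>"
    by (simp add: add.commute)
  with len have "b v - a v < pi * (real \<alpha> - 1) / \<alpha>" if "v \<in> verts G" for v
    using that by (meson le_less_trans)
  with le rep assms(1) have "box_representable G \<alpha>"
    by (intro box_representable_if_short_arcs[of \<alpha> G a b]) auto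
  then show ?thesis unfolding boxicity_def by (rule Least_le)
qed

end
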